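(* Let $T$ be a punctured tiling of $\mathbb R^d$ of finite local complexity which has equidistributed frequencies and whose patch counting function $P$ satisfies $P(4r)\le \tilde c\,P(r)$ for some constant $\tilde c$ and all sufficiently large $r$. Let $\delta:[0,\infty)\to(0,\infty)$ be a strictly decreasing function tending to $0$ at infinity, such that $\delta\in L^1([1,\infty),\frac{dx}{x})$ and $\delta(ar)\le\delta(a)\delta(r)$ for all sufficiently large $a$ and $r$. Equip the discrete tiling space $\Xi$ of $T$ with the ultrametric $d$ defined by $\delta$. Then the metrics $\overline d_s=\sup_\tau d_s^\tau$ and $\underline d_s=\inf_\tau d_s^\tau$, where $\tau$ runs over all choice functions, are Lipschitz equivalent, i.e. there is $c>0$ with $\overline d_s\le c\,\underline d_s$.
   Context: Tilings. A punctured tiling is a tiling of $\mathbb R^d$ by tiles (compact sets homeomorphic to closed balls), each with a chosen interior point (puncture), translates of a tile carrying translated punctures; $T^{\mathrm{punc}}$ is the set of punctures. For $x\in T^{\mathrm{punc}}$ and $r\ge0$, the $r$-patch $B_{0,r}[T-x]$ is the set of tiles of $T-x$ whose punctures lie in the closed $r$-ball about $0$. $P(r)$ is the number of distinct $r$-patches; $T$ has finite local complexity if $P(r)<\infty$ for all $r$. The discrete tiling space $\Xi$ is the set of tilings having the same set of patches as $T$ and having a puncture at $0$. For $\xi\neq\eta$ in $\Xi$, $d(\xi,\eta)=\inf\{\delta(r):B_{0,r}[\xi]=B_{0,r}[\eta]\}$ (the infimum over the empty set being $\delta(0)$), $d(\xi,\xi)=0$; this is a compact ultrametric on $\Xi$.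 Frequencies. For an $r$-patch $p$ let $\mathrm{freq}(p)=\lim_{n\to\infty}\#\{x\in T^{\mathrm{punc}}\cap C_n: B_{0,r}[T-x]=p\}/\mathrm{vol}(C_n)$, $C_n$ being the cube of side length $n$ (centred at $0$). $T$ has equidistributed frequencies if these limits exist and there are constants $c,C>0$ with $cP(r)^{-1}\le\mathrm{freq}(p)\le CP(r)^{-1}$ for all $r$ and all $r$-patches $p$. Spectral distances. Let $(X,d)=(\Xi,d)$ and write the nonzero values of $d$ as a strictly decreasing sequence $\delta_0>\delta_1>\cdots$ (tending to $0$ if $X$ is infinite). Michon tree: level $n$ vertices are the closed $\delta_n$-balls of $X$ (a clopen partition); $[v]\subset X$ is the ball of the vertex $v$; there is a vertical edge from a level $n$ vertex $v$ to a level $n+1$ vertex $w$ iff $[w]\subset[v]$ (then $w$ is called a child of $v$). Points of $X$ correspond to infinite paths starting at the root. A choice function $\tau$ is given by choosing one child of every vertex; $\tau(v)\in X$ is the point whose path passes through $v$ and then follows the chosen children. Let $E$ be the set of ordered pairs $(v,w)$ of distinct vertices which are children of a common vertex $u$; if $u$ has level $n$ the pair has length $l(v,w)=\delta_n$ (the $d$-distance of any point of $[v]$ to any point of $[w]$). On $\ell^2(E)$ put $\pi_\tau(f)\psi(v,w)=f(\tau(v))\psi(v,w)$ for $f\in C(X)$ and $D\psi(v,w)=l(v,w)^{-1}\psi(w,v)$. Then $d_s^\tau(x,y)=\sup\{|f(x)-f(y)|:f\in C(X),\ \|[D,\pi_\tau(f)]\|\le1\}$, where $\|[D,\pi_\tau(f)]\|\le1$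 means $|f(\tau(v))-f(\tau(w))|\le l(v,w)$ for all $(v,w)\in E$. *)

theory Defs
  imports "HOL-Analysis.Analysis"
begin

section \<open>Punctured tilings and patches\<close>

text \<open>A punctured tile is a pair of a set and its puncture; a tiling is a set of such pairs.\<close>

type_synonym 'a tile = "'a set \<times> 'a"

definition punctured_tiling :: "'a::euclidean_space tile set \<Rightarrow> bool" where
  "punctured_tiling T \<longleftrightarrow>
     (\<forall>(t, x) \<in> T. compact t \<and> t homeomorphic cball (0::'a) 1 \<and> x \<in> interior t) \<and>
     (\<Union>(t, x) \<in> T. t) = UNIV \<and>
     (\<forall>(s, x) \<in> T. \<forall>(t, y) \<in> T. (s, x) \<noteq> (t, y) \<longrightarrow> interior s \<inter> interior t = {}) \<and>
     (\<forall>(s, x) \<in> T. \<forall>(t, y) \<in> T. \<forall>v. t = (+) v ` s \<longrightarrow> y = v + x)"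

definition punctures :: "'a tile set \<Rightarrow> 'a set" where
  "punctures T = snd ` T"

text \<open>The translate \<open>T - x\<close>.\<close>

definition shift :: "'a::euclidean_space tile set \<Rightarrow> 'a \<Rightarrow> 'a tile set" where
  "shift T x = (\<lambda>(t, y). ((\<lambda>z. z - x) ` t, y - x)) ` T"

definition ball_patch :: "real \<Rightarrow> 'a::euclidean_space tile set \<Rightarrow> 'a tile set" where
  "ball_patch r T = {(t, y) \<in> T. y \<in> cball 0 r}"

definition r_patches :: "'a::euclidean_space tile set \<Rightarrow> real \<Rightarrow> 'a tile set set" where
  "r_patches T r = (\<lambda>x. ball_patch r (shift T x)) ` punctures T"

definition all_patches :: "'a::euclidean_space tile set \<Rightarrow> 'a tile set set" where
  "all_patches T = (\<Union>r\<in>{0..}. r_patches T r)"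

definition finite_local_complexity :: "'a::euclidean_space tile set \<Rightarrow> bool" where
  "finite_local_complexity T \<longleftrightarrow> (\<forall>r\<ge>0. finite (r_patches T r))"

definition patch_count :: "'a::euclidean_space tile set \<Rightarrow> real \<Rightarrow> nat" where
  "patch_count T r = card (r_patches T r)"

definition centred_cube :: "real \<Rightarrow> 'a::euclidean_space set" where
  "centred_cube s = cbox (- ((s / 2) *\<^sub>R One)) ((s / 2) *\<^sub>R One)"

definition patch_density ::
    "'a::euclidean_space tile set \<Rightarrow> real \<Rightarrow> 'a tile set \<Rightarrow> nat \<Rightarrow> real" where
  "patch_density T r p n =
     real (card {x \<in> punctures T \<inter> centred_cube (real n). ball_patch r (shift T x) = p})
       / measure lborel (centred_cube (real n) :: 'a set)"

definition equidistributed_frequencies :: "'a::euclidean_space tile set \<Rightarrow> bool" where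
  "equidistributed_frequencies T \<longleftrightarrow>
     (\<forall>r\<ge>0. \<forall>p \<in> r_patches T r. convergent (patch_density T r p)) \<and>
     (\<exists>c>0. \<exists>C>0. \<forall>r\<ge>0. \<forall>p \<in> r_patches T r.
        c / real (patch_count T r) \<le> lim (patch_density T r p) \<and>
        lim (patch_density T r p) \<le> C / real (patch_count T r))"

definition discrete_tiling_space :: "'a::euclidean_space tile set \<Rightarrow> 'a tile set set" where
  "discrete_tiling_space T =
     {S. punctured_tiling S \<and> all_patches S = all_patches T \<and> 0 \<in> punctures S}"

definition tiling_dist ::
    "(real \<Rightarrow> real) \<Rightarrow> 'a::euclidean_space tile set \<Rightarrow> 'a tile set \<Rightarrow> real" where
  "tiling_dist \<delta> S S' =
     (let R = {r. 0 \<le> r \<and> ball_patch r S = ball_patch r S'}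
      in if S = S' then 0 else if R = {} then \<delta> 0 else Inf (\<delta> ` R))"

section \<open>Michon tree and spectral distances\<close>

text \<open>
  In this section \<open>(X, d)\<close> is thought of as a compact ultrametric space. The \<open>n\<close>-th largest nonzero value of
  \<open>d\<close> is \<open>dist_level X d n\<close>. If there are only finitely many values, the sequence is continued
  by \<open>0\<close>: the vertices at the remaining levels are then the singletons, each having exactly one
  child, so that also for finite \<open>X\<close> the points correspond to the infinite paths.
\<close>

definition dist_values :: "'x set \<Rightarrow> ('x \<Rightarrow> 'x \<Rightarrow> real) \<Rightarrow> real set" where
  "dist_values X d = {d x y | x y. x \<in> X \<and> y \<in> X} - {0}"

definition is_dist_level :: "'x set \<Rightarrow> ('x \<Rightarrow> 'x \<Rightarrow> real) \<Rightarrow> nat \<Rightarrow> real \<Rightarrow> bool" where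
  "is_dist_level X d n s \<longleftrightarrow>
     s \<in> dist_values X d \<and>
     finite {t \<in> dist_values X d. s < t} \<and> card {t \<in> dist_values X d. s < t} = n"

definition dist_level :: "'x set \<Rightarrow> ('x \<Rightarrow> 'x \<Rightarrow> real) \<Rightarrow> nat \<Rightarrow> real" where
  "dist_level X d n =
     (if \<exists>s. is_dist_level X d n s then THE s. is_dist_level X d n s else 0)"

text \<open>
  A vertex is a ball together with its level; the same ball may occur at several levels.
\<close>

type_synonym 'x vertex = "nat \<times> 'x set"

definition vertices :: "'x set \<Rightarrow> ('x \<Rightarrow> 'x \<Rightarrow> real) \<Rightarrow> 'x vertex set" where
  "vertices X d = {(n, Metric_space.mcball X d x (dist_level X d n)) | n x. x \<in> X}"

definition is_child ::
    "'x set \<Rightarrow> ('x \<Rightarrow> 'x \<Rightarrow> real) \<Rightarrow> 'x vertex \<Rightarrow> 'x vertex \<Rightarrow> bool" where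
  "is_child X d w v \<longleftrightarrow>
     v \<in> vertices X d \<and> w \<in> vertices X d \<and> fst w = Suc (fst v) \<and> snd w \<subseteq> snd v"

text \<open>
  \<open>follows X \<tau> v x\<close>: the path of the point \<open>x\<close> passes through \<open>v\<close> and then follows the children
  chosen by \<open>\<tau>\<close>. Every vertex must determine such a point. This is automatic if \<open>X\<close> is compact
  (a decreasing sequence of nonempty balls has a common point); requiring it explicitly ensures
  that \<open>chosen_point\<close> is meaningful without a proof of compactness.
\<close>

definition follows :: "'x set \<Rightarrow> ('x vertex \<Rightarrow> 'x vertex) \<Rightarrow> 'x vertex \<Rightarrow> 'x \<Rightarrow> bool" where
  "follows X \<tau> v x \<longleftrightarrow> x \<in> X \<and> (\<forall>k. x \<in> snd ((\<tau> ^^ k) v))"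

definition choice_functions ::
    "'x set \<Rightarrow> ('x \<Rightarrow> 'x \<Rightarrow> real) \<Rightarrow> ('x vertex \<Rightarrow> 'x vertex) set" where
  "choice_functions X d =
     {\<tau>. \<forall>v \<in> vertices X d. is_child X d (\<tau> v) v \<and> (\<exists>x. follows X \<tau> v x)}"

text \<open>The point usually written \<open>\<tau>(v)\<close>.\<close>

definition chosen_point :: "'x set \<Rightarrow> ('x vertex \<Rightarrow> 'x vertex) \<Rightarrow> 'x vertex \<Rightarrow> 'x" where
  "chosen_point X \<tau> v = (THE x. follows X \<tau> v x)"

definition sibling_pairs ::
    "'x set \<Rightarrow> ('x \<Rightarrow> 'x \<Rightarrow> real) \<Rightarrow> ('x vertex \<times> 'x vertex) set" where
  "sibling_pairs X d = {(v, w). v \<noteq> w \<and> (\<exists>u. is_child X d v u \<and> is_child X d w u)}"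

text \<open>For siblings \<open>v\<close>, \<open>w\<close> the common parent has level \<open>fst v - 1\<close>.\<close>

definition pair_length ::
    "'x set \<Rightarrow> ('x \<Rightarrow> 'x \<Rightarrow> real) \<Rightarrow> 'x vertex \<Rightarrow> 'x vertex \<Rightarrow> real" where
  "pair_length X d v w = dist_level X d (fst v - 1)"

text \<open>
  The continuous functions \<open>f\<close> on \<open>X\<close> with \<open>\<parallel>[D, \<pi>\<^sub>\<tau>(f)]\<parallel> \<le> 1\<close>. The commutator acts on \<open>\<psi>\<close> by
  \<open>[D, \<pi>\<^sub>\<tau>(f)]\<psi>(v, w) = (f(\<tau>(w)) - f(\<tau>(v))) / l(v, w) * \<psi>(w, v)\<close>, so the condition on its norm
  is the one on the differences of \<open>f\<close> below.
\<close>

definition spectral_unit_ball ::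
    "'x set \<Rightarrow> ('x \<Rightarrow> 'x \<Rightarrow> real) \<Rightarrow> ('x vertex \<Rightarrow> 'x vertex) \<Rightarrow> ('x \<Rightarrow> complex) set" where
  "spectral_unit_ball X d \<tau> =
     {f. continuous_map (Metric_space.mtopology X d) euclidean f \<and>
         (\<forall>(v, w) \<in> sibling_pairs X d.
            cmod (f (chosen_point X \<tau> v) - f (chosen_point X \<tau> w)) \<le> pair_length X d v w)}"

text \<open>A priori the supremum may be infinite, hence the values in \<^typ>\<open>ennreal\<close>.\<close>

definition spectral_dist ::
    "'x set \<Rightarrow> ('x \<Rightarrow> 'x \<Rightarrow> real) \<Rightarrow> ('x vertex \<Rightarrow> 'x vertex) \<Rightarrow> 'x \<Rightarrow> 'x \<Rightarrow> ennreal" where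
  "spectral_dist X d \<tau> x y = (SUP f \<in> spectral_unit_ball X d \<tau>. ennreal (cmod (f x - f y)))"

definition spectral_dist_sup ::
    "'x set \<Rightarrow> ('x \<Rightarrow> 'x \<Rightarrow> real) \<Rightarrow> 'x \<Rightarrow> 'x \<Rightarrow> ennreal" where
  "spectral_dist_sup X d x y = (SUP \<tau> \<in> choice_functions X d. spectral_dist X d \<tau> x y)"

definition spectral_dist_inf ::
    "'x set \<Rightarrow> ('x \<Rightarrow> 'x \<Rightarrow> real) \<Rightarrow> 'x \<Rightarrow> 'x \<Rightarrow> ennreal" where
  "spectral_dist_inf X d x y = (INF \<tau> \<in> choice_functions X d. spectral_dist X d \<tau> x y)"

end

theory Submission
  imports Defs
begin

text \<open>
  For every choice function \<open>\<tau>\<close>, an indicator function shows \<open>d x y \<le> d\<^sub>s x y\<close>. Conversely, telescoping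
  along the paths of \<open>x\<close> and \<open>y\<close> bounds \<open>d\<^sub>s x y\<close> by \<open>d x y\<close> plus the sum of the distances smaller than
  \<open>d x y\<close> that occur from \<open>x\<close>, and the same sum for \<open>y\<close>. So it suffices to bound such a sum by a
  constant times \<open>d x y\<close>. The \<open>s\<close>-patches extending a given \<open>r\<close>-patch have frequencies at least
  \<open>c / P s\<close> which add up to at most \<open>C / P r\<close>; hence there are at most \<open>(C / c) * (P s / P r)\<close> of them.
  For \<open>s = a * r\<close> this is bounded, so boundedly many distances occur per scale \<open>[r, a * r]\<close>. If \<open>a\<close> is
  chosen with \<open>\<delta> a \<le> 1/2\<close>, then \<open>\<delta> (a ^ j * r) \<le> \<delta> r / 2 ^ j\<close> and the sum is dominated by a geometric
  series.
\<close>

section \<open>Spectral distances on ultrametric spaces\<close>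

text \<open>Finiteness of the values above each positive bound stands in for compactness: it lets
  the distances be listed in decreasing order with limit 0.\<close>

locale levelled_ultrametric = Metric_space M d for M :: "'x set" and d :: "'x \<Rightarrow> 'x \<Rightarrow> real" +
  assumes ultra: "\<lbrakk>x \<in> M; y \<in> M; z \<in> M\<rbrakk> \<Longrightarrow> d x z \<le> max (d x y) (d y z)"
    and finite_values: "0 < \<epsilon> \<Longrightarrow> finite {t \<in> dist_values M d. \<epsilon> < t}"
begin

abbreviation level :: "nat \<Rightarrow> real" where
  "level \<equiv> dist_level M d"

text \<open>The vertices \<open>vert 0 x\<close>, \<open>vert 1 x\<close>, ... are the path of
  \<open>x\<close> in the Michon tree.\<close>

abbreviation vert :: "nat \<Rightarrow> 'x \<Rightarrow> 'x vertex" where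
  "vert k x \<equiv> (k, mcball x (level k))"

section \<open>The distances in decreasing order\<close>

lemma dist_values_pos: "s \<in> dist_values M d \<Longrightarrow> 0 < s"
  unfolding dist_values_def by (auto simp: less_le)

lemma is_dist_level_unique:
  assumes "is_dist_level M d n s" "is_dist_level M d n t"
  shows "s = t"
proof -
  have "\<not> s < t" if "is_dist_level M d n s" "is_dist_level M d n t" for s t
  proof
    assume "s < t"
    then have "{u \<in> dist_values M d. t < u} \<subset> {u \<in> dist_values M d. s < u}"
      using that unfolding is_dist_level_def by auto
    then show False
      using that psubset_card_mono unfolding is_dist_level_def by (metis less_irrefl)
  qed
  then show ?thesis
    using assms by (meson linorder_less_linear)
qed

lemma level_eqI: "is_dist_level M d n s \<Longrightarrow> level n = s"
  unfolding dist_level_def using is_dist_level_unique by (auto intro!: the_equality)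

lemma is_dist_level_level: "level n \<noteq> 0 \<Longrightarrow> is_dist_level M d n (level n)"
  by (metis dist_level_def level_eqI)

lemma level_nonneg: "0 \<le> level n"
  using is_dist_level_level[of n] dist_values_pos
  unfolding is_dist_level_def by fastforce

lemma value_is_level:
  assumes "s \<in> dist_values M d"
  obtains n where "level n = s"
  using assms finite_values[OF dist_values_pos[OF assms]] level_eqI
  unfolding is_dist_level_def by blast

text \<open>The least of the \<open>Suc n\<close> values above \<open>level (Suc n)\<close> has
  exactly \<open>n\<close> values above it, hence is \<open>level n\<close>.\<close>

lemma level_Suc_less:
  assumes "0 < level (Suc n)"
  shows "level (Suc n) < level n"
proof -
  define A where "A = {t \<in> dist_values M d. level (Suc n) < t}"
  have A: "finite A" "card A = Suc n"
    using is_dist_level_level[of "Suc n"] assms unfolding A_def is_dist_level_def by auto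
  then have "A \<noteq> {}"
    by auto
  then have min: "Min A \<in> A"
    using A by simp
  have "{t \<in> dist_values M d. Min A < t} = A - {Min A}"
  proof (intro equalityI subsetI)
    fix t assume "t \<in> A - {Min A}"
    then show "t \<in> {t \<in> dist_values M d. Min A < t}"
      using Min_le[OF A(1), of t] unfolding A_def by auto
  next
    fix t assume "t \<in> {t \<in> dist_values M d. Min A < t}"
    then show "t \<in> A - {Min A}"
      using min unfolding A_def by auto
  qed
  then have "is_dist_level M d n (Min A)"
    using A min unfolding is_dist_level_def by (auto simp: A_def)
  then have "level n = Min A"
    by (rule level_eqI)
  then show ?thesis
    using min unfolding A_def by auto
qed

lemma level_antimono: "m \<le> n \<Longrightarrow> level n \<le> level m"
proof (rule lift_Suc_antimono_le[of level])
  show "level (Suc n) \<le> level n" for n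
    using level_Suc_less[of n] level_nonneg[of n] level_nonneg[of "Suc n"] by force
qed

lemma level_strict_antimono:
  assumes "m < n" "0 < level m"
  shows "level n < level m"
proof -
  have "level n \<le> level (Suc m)"
    using assms by (intro level_antimono) auto
  also have "\<dots> < level m"
    using level_Suc_less[of m] level_nonneg[of "Suc m"] assms(2) by force
  finally show ?thesis .
qed

lemma dist_is_level:
  assumes "x \<in> M" "y \<in> M" "x \<noteq> y"
  obtains n where "level n = d x y" "0 < level n"
proof -
  have "d x y \<in> dist_values M d"
    using assms unfolding dist_values_def by auto
  then show ?thesis
    using value_is_level dist_values_pos that by metis
qed

text \<open>Every nonzero distance is a level, so none lies strictly between consecutive levels.
  This turns strict bounds into closed balls of the next level.\<close>

lemma dist_less_level:
  assumes "x \<in> M" "y \<in> M" "d x y < level n"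
  shows "d x y \<le> level (Suc n)"
proof (cases "x = y")
  case True
  then show ?thesis
    using assms level_nonneg by simp
next
  case False
  then obtain m where m: "level m = d x y"
    using assms dist_is_level by metis
  then have "n < m"
    using assms level_antimono[of m n] by force
  then show ?thesis
    using level_antimono[of "Suc n" m] m by simp
qed

text \<open>The level of index \<open>card A\<close> cannot exceed \<open>\<epsilon> / 2\<close>: it
  would be an element of \<open>A\<close>, with fewer than \<open>card A\<close> values above
  it.\<close>

lemma level_tendsto_0: "level \<longlonglongrightarrow> 0"
proof (rule LIMSEQ_I)
  fix \<epsilon> :: real assume "0 < \<epsilon>"
  define A where "A = {t \<in> dist_values M d. \<epsilon> / 2 < t}"
  have "finite A"
    using finite_values[of "\<epsilon> / 2"] \<open>0 < \<epsilon>\<close> unfolding A_def by simp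
  have "level (card A) \<le> \<epsilon> / 2"
  proof (rule ccontr)
    assume *: "\<not> level (card A) \<le> \<epsilon> / 2"
    then have lev: "is_dist_level M d (card A) (level (card A))"
      using \<open>0 < \<epsilon>\<close> by (intro is_dist_level_level) auto
    then have "level (card A) \<in> A"
      using * unfolding is_dist_level_def A_def by simp
    then have "{t \<in> dist_values M d. level (card A) < t} \<subset> A"
      unfolding A_def by auto
    then have "card {t \<in> dist_values M d. level (card A) < t} < card A"
      by (rule psubset_card_mono[OF \<open>finite A\<close>])
    then show False
      using lev unfolding is_dist_level_def by simp
  qed
  then have "norm (level n - 0) < \<epsilon>" if "card A \<le> n" for n
    using level_antimono[OF that] level_nonneg[of n] \<open>0 < \<epsilon>\<close> by simp
  then show "\<exists>N. \<forall>n\<ge>N. norm (level n - 0) < \<epsilon>"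
    by blast
qed

section \<open>Balls, vertices and the points selected by a choice function\<close>

lemma mcball_eq:
  assumes "y \<in> mcball x r"
  shows "mcball y r = mcball x r"
proof -
  have *: "x \<in> M" "y \<in> M" "d x y \<le> r"
    using assms by auto
  show ?thesis
  proof (intro equalityI subsetI)
    fix z assume "z \<in> mcball y r"
    then show "z \<in> mcball x r"
      using * ultra[of x y z] by auto
  next
    fix z assume "z \<in> mcball x r"
    then show "z \<in> mcball y r"
      using * ultra[of y x z] commute[of x y] by auto
  qed
qed

lemma vert_in_vertices: "x \<in> M \<Longrightarrow> vert k x \<in> vertices M d"
  unfolding vertices_def by blast

lemma vertexE:
  assumes "v \<in> vertices M d"
  obtains x where "x \<in> M" "x \<in> snd v" "v = vert (fst v) x"
proof -
  obtain n x where nx: "v = vert n x" "x \<in> M"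
    using assms unfolding vertices_def by blast
  then have "x \<in> snd v"
    using level_nonneg[of n] by simp
  then show ?thesis
    using that nx by simp
qed

lemma vertex_eq_vert:
  assumes "v \<in> vertices M d" "x \<in> snd v"
  shows "v = vert (fst v) x" "x \<in> M"
proof -
  obtain z where z: "v = vert (fst v) z" "z \<in> M"
    using vertexE[OF assms(1)] by metis
  then have "x \<in> mcball z (level (fst v))"
    using assms(2) by (metis snd_conv)
  then show "v = vert (fst v) x" "x \<in> M"
    using mcball_eq z(1) by auto
qed

lemma is_child_vert:
  assumes "x \<in> M"
  shows "is_child M d (vert (Suc k) x) (vert k x)"
  using assms level_antimono[of k "Suc k"] vert_in_vertices unfolding is_child_def by auto

lemma choice_function_vertex:
  assumes "\<tau> \<in> choice_functions M d" "v \<in> vertices M d"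
  shows "is_child M d (\<tau> v) v" "\<tau> v \<in> vertices M d" "fst (\<tau> v) = Suc (fst v)"
  using assms unfolding choice_functions_def is_child_def by auto

lemma choice_function_iterate:
  assumes "\<tau> \<in> choice_functions M d" "v \<in> vertices M d"
  shows "(\<tau> ^^ k) v \<in> vertices M d \<and> fst ((\<tau> ^^ k) v) = fst v + k"
  using assms choice_function_vertex by (induction k) auto

text \<open>Distinct points are at some distance \<open>level m\<close>; after \<open>Suc m\<close>
  steps down the path, the ball is too small to contain both.\<close>

lemma follows_unique:
  assumes \<tau>: "\<tau> \<in> choice_functions M d" and v: "v \<in> vertices M d"
    and x: "follows M \<tau> v x" and y: "follows M \<tau> v y"
  shows "x = y"
proof (rule ccontr)
  assume "x \<noteq> y"
  have M: "x \<in> M" "y \<in> M"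
    using x y unfolding follows_def by auto
  then obtain m where m: "level m = d x y" "0 < level m"
    using \<open>x \<noteq> y\<close> dist_is_level by metis
  define u where "u = (\<tau> ^^ Suc m) v"
  have u: "u \<in> vertices M d" "fst u = fst v + Suc m"
    using choice_function_iterate[OF \<tau> v, of "Suc m"] unfolding u_def by auto
  have "x \<in> snd u" "y \<in> snd u"
    using x y unfolding follows_def u_def by blast+
  then have "y \<in> mcball x (level (fst u))"
    using vertex_eq_vert(1)[OF u(1), of x] by (metis snd_conv)
  then have "d x y \<le> level (fst u)"
    by simp
  then show False
    using level_strict_antimono[of m "fst u"] m u(2) by simp
qed

text \<open>By uniqueness, the paths prescribed below \<open>v\<close> and below
  \<open>\<tau> v\<close> end at the same point. Descending to the chosen child thus leaves the
  value of a function unchanged, and telescoping sums shrink to the branching levels.\<close>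

lemma chosen_point:
  assumes \<tau>: "\<tau> \<in> choice_functions M d" and v: "v \<in> vertices M d"
  shows "chosen_point M \<tau> v \<in> snd v" "chosen_point M \<tau> v \<in> M"
    "chosen_point M \<tau> (\<tau> v) = chosen_point M \<tau> v"
proof -
  have ex: "\<exists>x. follows M \<tau> u x" if "u \<in> vertices M d" for u
    using that \<tau> unfolding choice_functions_def by blast
  have f: "follows M \<tau> u (chosen_point M \<tau> u)" if "u \<in> vertices M d" for u
    unfolding chosen_point_def
    using ex[OF that] follows_unique[OF \<tau> that] by (metis theI')
  have "chosen_point M \<tau> v \<in> snd ((\<tau> ^^ 0) v)"
    using f[OF v] unfolding follows_def by blast
  then show "chosen_point M \<tau> v \<in> snd v"
    by simp
  show "chosen_point M \<tau> v \<in> M"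
    using f[OF v] unfolding follows_def by blast
  have "chosen_point M \<tau> v \<in> snd ((\<tau> ^^ k) (\<tau> v))" for k
    using f[OF v] unfolding follows_def by (metis funpow_simps_right(2) comp_apply)
  then have "follows M \<tau> (\<tau> v) (chosen_point M \<tau> v)"
    using f[OF v] unfolding follows_def by blast
  then show "chosen_point M \<tau> (\<tau> v) = chosen_point M \<tau> v"
    using follows_unique[OF \<tau>] f choice_function_vertex[OF \<tau> v] by blast
qed

text \<open>
  The lower bound is witnessed by a multiple of the indicator function of the ball of radius
  \<open>level (Suc n)\<close> around \<open>x\<close>, where \<open>d x y = level n\<close>.
\<close>

lemma spectral_dist_ge:
  assumes \<tau>: "\<tau> \<in> choice_functions M d" and x: "x \<in> M" and y: "y \<in> M"
  shows "ennreal (d x y) \<le> spectral_dist M d \<tau> x y"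
proof (cases "x = y")
  case True
  then show ?thesis
    using x by simp
next
  case False
  obtain n where n: "level n = d x y" "0 < level n"
    using False x y dist_is_level by metis
  define f :: "'x \<Rightarrow> complex"
    where "f z = (if z \<in> mcball x (level (Suc n)) then of_real (level n) else 0)" for z
  have f_eq: "f z = f w" if "w \<in> mcball z (level (Suc n))" for z w
  proof -
    have "z \<in> mcball x (level (Suc n)) \<longleftrightarrow> w \<in> mcball x (level (Suc n))"
      using that mcball_eq by (metis commute in_mcball)
    then show ?thesis
      by (simp add: f_def)
  qed
  have "continuous_map mtopology euclidean f"
    unfolding continuous_map_def
  proof (intro conjI allI impI)
    fix U :: "complex set"
    \<comment> \<open>The open ball of radius \<open>level n\<close> lies in the closed ball of the
      next level, on which \<open>f\<close> is constant.\<close>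
    have "mball z (level n) \<subseteq> {w \<in> M. f w \<in> U}" if "z \<in> M" "f z \<in> U" for z
    proof
      fix w assume w: "w \<in> mball z (level n)"
      then have "w \<in> mcball z (level (Suc n))"
        using dist_less_level[of z w n] by simp
      then show "w \<in> {w \<in> M. f w \<in> U}"
        using f_eq that w by auto
    qed
    then show "openin mtopology {w \<in> topspace mtopology. f w \<in> U}"
      unfolding openin_mtopology using n(2) by auto
  qed auto
  moreover have "cmod (f (chosen_point M \<tau> v) - f (chosen_point M \<tau> w)) \<le> pair_length M d v w"
    if sib: "(v, w) \<in> sibling_pairs M d" for v w
  proof -
    obtain u where u: "is_child M d v u" "is_child M d w u"
      using sib unfolding sibling_pairs_def by blast
    define k where "k = fst u"
    have V: "u \<in> vertices M d" "v \<in> vertices M d" "w \<in> vertices M d" "fst v = Suc k"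
      "snd v \<subseteq> snd u" "snd w \<subseteq> snd u"
      using u unfolding is_child_def k_def by auto
    have l: "pair_length M d v w = level k"
      using V unfolding pair_length_def by simp
    \<comment> \<open>A pair below a parent of level at most \<open>n\<close> has length at least
      \<open>level n\<close>, the oscillation of \<open>f\<close>. Below a deeper parent, both
      chosen points lie in one ball on which \<open>f\<close> is constant.\<close>
    show ?thesis
    proof (cases "k \<le> n")
      case True
      have "cmod (f (chosen_point M \<tau> v) - f (chosen_point M \<tau> w)) \<le> level n"
        using n(2) by (auto simp: f_def)
      then show ?thesis
        using level_antimono[OF True] l by simp
    next
      case False
      have c: "chosen_point M \<tau> v \<in> snd u" "chosen_point M \<tau> w \<in> snd u"
        using chosen_point(1)[OF \<tau> V(2)] chosen_point(1)[OF \<tau> V(3)] V(5,6) by blast+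
      then have "chosen_point M \<tau> w \<in> mcball (chosen_point M \<tau> v) (level k)"
        using vertex_eq_vert(1)[OF V(1)] unfolding k_def by (metis snd_conv)
      then have "chosen_point M \<tau> w \<in> mcball (chosen_point M \<tau> v) (level (Suc n))"
        using level_antimono[of "Suc n" k] False by auto
      then have "f (chosen_point M \<tau> v) = f (chosen_point M \<tau> w)"
        by (rule f_eq)
      then show ?thesis
        using l level_nonneg by simp
    qed
  qed
  ultimately have "f \<in> spectral_unit_ball M d \<tau>"
    unfolding spectral_unit_ball_def by blast
  then have "ennreal (cmod (f x - f y)) \<le> spectral_dist M d \<tau> x y"
    unfolding spectral_dist_def by (rule SUP_upper)
  moreover have "cmod (f x - f y) = d x y"
  proof -
    have "level (Suc n) < d x y"
      using level_strict_antimono[of n "Suc n"] n by simp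
    then have "f y = 0"
      unfolding f_def by simp
    moreover have "f x = of_real (level n)"
      unfolding f_def using x level_nonneg by simp
    ultimately show ?thesis
      using n by simp
  qed
  ultimately show ?thesis
    by simp
qed

text \<open>
  Along the path of \<open>x\<close>, the value of \<open>f\<close> at the chosen points changes only at levels where the path
  leaves the one prescribed by \<open>\<tau>\<close>; there the path branches, so the level is a distance from \<open>x\<close>.
\<close>

lemma vert_diff_le:
  assumes \<tau>: "\<tau> \<in> choice_functions M d" and f: "f \<in> spectral_unit_ball M d \<tau>" and x: "x \<in> M"
    and ne: "vert (Suc k) x \<noteq> \<tau> (vert k x)"
  shows "\<exists>y\<in>M. d x y = level k" "0 < level k"
    "cmod (f (chosen_point M \<tau> (vert (Suc k) x)) - f (chosen_point M \<tau> (vert k x))) \<le> level k"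
proof -
  define v where "v = vert k x"
  have v: "v \<in> vertices M d" "fst v = k"
    using x vert_in_vertices unfolding v_def by auto
  \<comment> \<open>The point chosen at \<open>v\<close> lies in the chosen child, which is not the
    child containing \<open>x\<close>. Its distance from \<open>x\<close> therefore exceeds
    \<open>level (Suc k)\<close>, hence equals \<open>level k\<close>.\<close>
  define y where "y = chosen_point M \<tau> v"
  have y: "y \<in> mcball x (level k)" "y \<in> M" "y \<in> snd (\<tau> v)"
    using chosen_point[OF \<tau> v(1)] chosen_point(1)[OF \<tau> choice_function_vertex(2)[OF \<tau> v(1)]]
    unfolding y_def by (auto simp: v_def)
  have "\<tau> v = vert (Suc k) y"
    using vertex_eq_vert(1)[OF choice_function_vertex(2)[OF \<tau> v(1)] y(3)]
      choice_function_vertex(3)[OF \<tau> v(1)] v(2) by simp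
  then have "y \<notin> mcball x (level (Suc k))"
    using ne mcball_eq unfolding v_def by auto
  then have gt: "level (Suc k) < d x y"
    using x y by auto
  then have "level k \<le> d x y"
    using dist_less_level[of x y k] x y by force
  then have "d x y = level k"
    using y(1) by auto
  then show "\<exists>y\<in>M. d x y = level k" "0 < level k"
    using y(2) gt level_nonneg[of "Suc k"] by auto
  have "(vert (Suc k) x, \<tau> v) \<in> sibling_pairs M d"
    unfolding sibling_pairs_def
    using is_child_vert[OF x, of k] choice_function_vertex(1)[OF \<tau> v(1)] ne v_def by blast
  then have "cmod (f (chosen_point M \<tau> (vert (Suc k) x)) - f (chosen_point M \<tau> (\<tau> v)))
      \<le> pair_length M d (vert (Suc k) x) (\<tau> v)"
    using f unfolding spectral_unit_ball_def by blast
  then show "cmod (f (chosen_point M \<tau> (vert (Suc k) x)) - f (chosen_point M \<tau> (vert k x))) \<le> level k"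
    using chosen_point(3)[OF \<tau> v(1)] unfolding pair_length_def v_def by simp
qed

text \<open>The point chosen at \<open>vert k x\<close> is within \<open>level k\<close> of
  \<open>x\<close>. Continuity of \<open>f\<close> then allows the telescoping sums to reach
  \<open>f x\<close>.\<close>

lemma chosen_point_tendsto:
  assumes \<tau>: "\<tau> \<in> choice_functions M d" and f: "f \<in> spectral_unit_ball M d \<tau>" and x: "x \<in> M"
  shows "(\<lambda>k. f (chosen_point M \<tau> (vert k x))) \<longlonglongrightarrow> f x"
proof -
  have c: "chosen_point M \<tau> (vert k x) \<in> M" "d x (chosen_point M \<tau> (vert k x)) \<le> level k" for k
    using chosen_point(1,2)[OF \<tau> vert_in_vertices[OF x]] by (metis, metis in_mcball snd_conv)
  have "(\<lambda>k. d (chosen_point M \<tau> (vert k x)) x) \<longlonglongrightarrow> 0"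
    by (rule tendsto_sandwich[OF _ _ tendsto_const level_tendsto_0])
      (use c commute in \<open>auto intro!: always_eventually\<close>)
  then have "limitin mtopology (\<lambda>k. chosen_point M \<tau> (vert k x)) x sequentially"
    using c(1) x by (auto simp: limitin_metric_dist_null)
  moreover have "continuous_map mtopology euclidean f"
    using f unfolding spectral_unit_ball_def by blast
  ultimately have "limitin euclidean (f \<circ> (\<lambda>k. chosen_point M \<tau> (vert k x))) (f x) sequentially"
    by (rule continuous_map_limit[rotated])
  then show ?thesis
    by (simp add: o_def)
qed

text \<open>The two paths separate at one pair of siblings of length \<open>d x y\<close>, and each
  tail adds at most \<open>K * d x y\<close>; hence the factor \<open>2 * K + 1\<close>. Bounds for
  finite sets \<open>V\<close> suffice because a tail is cut off at some \<open>N\<close> before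
  passing to the limit.\<close>

lemma spectral_dist_le:
  assumes \<tau>: "\<tau> \<in> choice_functions M d" and x: "x \<in> M" and y: "y \<in> M"
    and sum_le: "\<And>x y V. \<lbrakk>x \<in> M; y \<in> M; finite V; V \<subseteq> d x ` M; \<And>v. v \<in> V \<Longrightarrow> 0 < v \<and> v < d x y\<rbrakk>
      \<Longrightarrow> \<Sum>V \<le> K * d x y"
  shows "spectral_dist M d \<tau> x y \<le> ennreal ((2 * K + 1) * d x y)"
proof (cases "x = y")
  case True
  then have "ennreal (cmod (f x - f y)) \<le> ennreal ((2 * K + 1) * d x y)" for f :: "'x \<Rightarrow> complex"
    using x by simp
  then show ?thesis
    unfolding spectral_dist_def by (rule SUP_least)
next
  case False
  obtain n where n: "level n = d x y" "0 < level n"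
    using False x y dist_is_level by metis
  have lt: "level (Suc n) < d x y"
    using level_strict_antimono[of n "Suc n"] n by simp
  have bound: "cmod (f x - f y) \<le> (2 * K + 1) * d x y" if f: "f \<in> spectral_unit_ball M d \<tau>" for f
  proof -
    define c where "c k z = chosen_point M \<tau> (vert k z)" for k z
    have tail: "cmod (f z - f (c (Suc n) z)) \<le> K * level n"
      if z: "z \<in> M" "z' \<in> M" "d z z' = level n" for z z'
    proof -
      have "cmod (f (c N z) - f (c (Suc n) z)) \<le> K * level n" if N: "Suc n \<le> N" for N
      proof -
        define A where "A = {k \<in> {Suc n..<N}. vert (Suc k) z \<noteq> \<tau> (vert k z)}"
        have A: "finite A"
          unfolding A_def by simp
        have step: "cmod (f (c (Suc k) z) - f (c k z))
            \<le> (if vert (Suc k) z \<noteq> \<tau> (vert k z) then level k else 0)" for k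
          using vert_diff_le(3)[OF \<tau> f z(1), of k]
            chosen_point(3)[OF \<tau> vert_in_vertices[OF z(1), of k]]
          by (cases "vert (Suc k) z = \<tau> (vert k z)") (simp_all add: c_def)
        have tele: "f (c N z) - f (c (Suc n) z) = (\<Sum>k = Suc n..<N. f (c (Suc k) z) - f (c k z))"
          using sum_Suc_diff'[OF N, of "\<lambda>k. f (c k z)"] by simp
        have "cmod (f (c N z) - f (c (Suc n) z))
            \<le> (\<Sum>k = Suc n..<N. if vert (Suc k) z \<noteq> \<tau> (vert k z) then level k else 0)"
          unfolding tele by (rule sum_norm_le) (rule step)
        also have "\<dots> = (\<Sum>k\<in>A. level k)"
          unfolding A_def by (rule sum.inter_filter[symmetric]) simp
        also have "\<dots> = \<Sum>(level ` A)"
        proof (rule sum.reindex_cong[symmetric, OF _ refl refl])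
          \<comment> \<open>Different indices share a level only at the padding value 0, which
            positivity excludes on \<open>A\<close>.\<close>
          have pos: "0 < level k" if "k \<in> A" for k
            using that vert_diff_le(2)[OF \<tau> f z(1), of k] unfolding A_def by blast
          show "inj_on level A"
          proof (rule inj_onI, rule ccontr)
            fix i j assume "i \<in> A" "j \<in> A" "level i = level j" "i \<noteq> j"
            then show False
              using level_strict_antimono[of i j] level_strict_antimono[of j i] pos
              by (metis less_irrefl nat_neq_iff)
          qed
        qed
        also have "\<dots> \<le> K * d z z'"
        proof (rule sum_le[OF z(1,2)])
          show "finite (level ` A)"
            using A by simp
          show "level ` A \<subseteq> d z ` M"
            using vert_diff_le(1)[OF \<tau> f z(1)] unfolding A_def by (auto simp: image_iff) metis
          show "0 < v \<and> v < d z z'" if v: "v \<in> level ` A" for v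
          proof -
            obtain k where k: "v = level k" "k \<in> A"
              using v by blast
            then have "0 < level k"
              using vert_diff_le(2)[OF \<tau> f z(1), of k] unfolding A_def by blast
            moreover have "level k < level n"
              using k n level_strict_antimono[of n k] unfolding A_def by simp
            ultimately show ?thesis
              using k z by simp
          qed
        qed
        finally show ?thesis
          using z by simp
      qed
      moreover have "(\<lambda>k. cmod (f (c k z) - f (c (Suc n) z))) \<longlonglongrightarrow> cmod (f z - f (c (Suc n) z))"
        unfolding c_def
        by (intro tendsto_norm tendsto_diff chosen_point_tendsto[OF \<tau> f z(1)] tendsto_const)
      ultimately show ?thesis
        by (blast intro: LIMSEQ_le_const2)
    qed
    \<comment> \<open>The paths share the vertex of level \<open>n\<close> and part immediately
      below it.\<close>
    have "vert (Suc n) x \<noteq> vert (Suc n) y"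
    proof
      assume "vert (Suc n) x = vert (Suc n) y"
      moreover have "y \<in> snd (vert (Suc n) y)"
        using y level_nonneg by simp
      ultimately have "y \<in> mcball x (level (Suc n))"
        by (metis snd_conv)
      then show False
        using lt by simp
    qed
    moreover have "vert n x = vert n y"
      using mcball_eq[of y x "level n"] n x y by simp
    ultimately have "(vert (Suc n) x, vert (Suc n) y) \<in> sibling_pairs M d"
      unfolding sibling_pairs_def using is_child_vert[OF x, of n] is_child_vert[OF y, of n] by auto
    then have "cmod (f (c (Suc n) x) - f (c (Suc n) y)) \<le> pair_length M d (vert (Suc n) x) (vert (Suc n) y)"
      using f unfolding spectral_unit_ball_def c_def by blast
    then have mid: "cmod (f (c (Suc n) x) - f (c (Suc n) y)) \<le> level n"
      unfolding pair_length_def by simp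
    have "cmod (f x - f y) \<le> cmod (f x - f (c (Suc n) x)) + cmod (f (c (Suc n) x) - f (c (Suc n) y))
        + cmod (f (c (Suc n) y) - f y)"
      by norm
    also have "\<dots> \<le> K * level n + level n + K * level n"
      using tail[OF x y] tail[OF y x] mid n commute[of x y]
      by (intro add_mono) (simp_all add: norm_minus_commute)
    also have "\<dots> = (2 * K + 1) * d x y"
      using n by (simp add: algebra_simps)
    finally show ?thesis .
  qed
  show ?thesis
    unfolding spectral_dist_def by (rule SUP_least, rule ennreal_leI, rule bound)
qed

text \<open>The metric \<open>d\<close> mediates: it bounds every \<open>spectral_dist\<close> from
  below and, up to the factor, from above, and neither bound depends on
  \<open>\<tau>\<close>.\<close>

lemma spectral_dist_sup_le:
  assumes "0 \<le> K" "x \<in> M" "y \<in> M"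
    and "\<And>x y V. \<lbrakk>x \<in> M; y \<in> M; finite V; V \<subseteq> d x ` M; \<And>v. v \<in> V \<Longrightarrow> 0 < v \<and> v < d x y\<rbrakk>
      \<Longrightarrow> \<Sum>V \<le> K * d x y"
  shows "spectral_dist_sup M d x y \<le> ennreal (2 * K + 1) * spectral_dist_inf M d x y"
proof -
  have "spectral_dist_sup M d x y \<le> ennreal ((2 * K + 1) * d x y)"
    unfolding spectral_dist_sup_def
    by (rule SUP_least, rule spectral_dist_le[OF _ assms(2,3)]) (use assms(4) in blast)+
  also have "\<dots> = ennreal (2 * K + 1) * ennreal (d x y)"
    using assms(1) by (simp add: ennreal_mult)
  also have "\<dots> \<le> ennreal (2 * K + 1) * spectral_dist_inf M d x y"
    unfolding spectral_dist_inf_def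
    by (rule mult_left_mono[OF INF_greatest[OF spectral_dist_ge]]) (use assms in auto)
  finally show ?thesis .
qed

end

section \<open>Patches, frequencies and local finiteness\<close>

lemma mem_ball_patch: "(t, y) \<in> ball_patch r S \<longleftrightarrow> (t, y) \<in> S \<and> norm y \<le> r"
  unfolding ball_patch_def by auto

lemma ball_patch_ball_patch: "ball_patch r (ball_patch s S) = ball_patch (min r s) S"
  unfolding ball_patch_def by auto

lemma ball_patch_eq_mono:
  assumes "ball_patch s S = ball_patch s S'" "r \<le> s"
  shows "ball_patch r S = ball_patch r S'"
  using assms ball_patch_ball_patch by (metis min.absorb1)

lemma tilings_differ_on_ball:
  assumes "S \<noteq> S'"
  obtains r where "0 \<le> r" "ball_patch r S \<noteq> ball_patch r S'"
proof -
  obtain t y where "(t, y) \<in> S \<and> (t, y) \<notin> S' \<or> (t, y) \<notin> S \<and> (t, y) \<in> S'"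
    using assms by auto
  then have "ball_patch (norm y) S \<noteq> ball_patch (norm y) S'"
    using mem_ball_patch by (metis order_refl)
  then show ?thesis
    using that by (metis norm_ge_zero)
qed

lemma shift_0 [simp]: "shift S 0 = S"
  unfolding shift_def by (auto simp: image_iff)

text \<open>A common puncture would be interior to both tiles, whereas distinct tiles have disjoint
  interiors. Counting tiles thus reduces to counting punctures.\<close>

lemma inj_on_snd_tiling:
  assumes "punctured_tiling T"
  shows "inj_on snd T"
proof (rule inj_onI)
  fix p q assume pq: "p \<in> T" "q \<in> T" "snd p = snd q"
  obtain s x t where eq: "p = (s, x)" "q = (t, x)"
    using pq(3) by (cases p, cases q) auto
  have "x \<in> interior s" "x \<in> interior t"
    using assms pq eq unfolding punctured_tiling_def by auto
  then have "interior s \<inter> interior t \<noteq> {}"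
    by blast
  then show "p = q"
    using assms pq eq unfolding punctured_tiling_def by blast
qed

lemma cball_subset_centred_cube:
  fixes r :: real
  assumes "2 * r \<le> s"
  shows "cball (0::'a::euclidean_space) r \<subseteq> centred_cube s"
proof
  fix x :: 'a assume "x \<in> cball 0 r"
  then have "\<bar>x \<bullet> i\<bar> \<le> s / 2" if "i \<in> Basis" for i
    using Basis_le_norm[OF that, of x] assms by simp
  then have "- (s / 2) \<le> x \<bullet> i \<and> x \<bullet> i \<le> s / 2" if "i \<in> Basis" for i
    using that by (metis abs_le_iff minus_le_iff)
  then show "x \<in> centred_cube s"
    unfolding centred_cube_def by (simp add: mem_box)
qed

text \<open>
  Positivity of the frequencies forces local finiteness: \<^const>\<open>card\<close> vanishes on infinite sets, so if a
  patch occurred infinitely often in a bounded region, its frequency would be \<open>0\<close>.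
\<close>

lemma finite_punctures_cball:
  fixes T :: "'a::euclidean_space tile set"
  assumes flc: "finite_local_complexity T" and freq: "equidistributed_frequencies T"
  shows "finite (punctures T \<inter> cball 0 r)"
proof -
  define occ where "occ p n = {x \<in> punctures T \<inter> centred_cube (real n). ball_patch 0 (shift T x) = p}"
    for p n
  have fin: "finite (r_patches T 0)"
    using flc unfolding finite_local_complexity_def by simp
  have "\<forall>\<^sub>F n in sequentially. finite (occ p n)" if p: "p \<in> r_patches T 0" for p
  proof -
    obtain c where c: "c > 0" "c / real (patch_count T 0) \<le> lim (patch_density T 0 p)"
      using freq p unfolding equidistributed_frequencies_def by (metis order_refl)
    have "0 < patch_count T 0"
      using fin p unfolding patch_count_def by (auto simp: card_gt_0_iff)
    then have "0 < lim (patch_density T 0 p)"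
      using c by (smt (verit) divide_pos_pos of_nat_0_less_iff)
    moreover have "patch_density T 0 p \<longlonglongrightarrow> lim (patch_density T 0 p)"
      using freq p unfolding equidistributed_frequencies_def by (simp add: convergent_LIMSEQ_iff)
    ultimately have "\<forall>\<^sub>F n in sequentially. 0 < patch_density T 0 p n"
      by (rule order_tendstoD(1)[rotated])
    then show ?thesis
    proof (rule eventually_mono)
      fix n assume "0 < patch_density T 0 p n"
      then have "card (occ p n) \<noteq> 0"
        unfolding patch_density_def occ_def by (metis div_0 less_irrefl of_nat_0)
      then show "finite (occ p n)"
        by (metis card.infinite)
    qed
  qed
  then have "\<forall>\<^sub>F n in sequentially. \<forall>p \<in> r_patches T 0. finite (occ p n)"
    using fin by (simp add: eventually_ball_finite)
  moreover have "\<forall>\<^sub>F n in sequentially. 2 * r \<le> real n"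
    using filterlim_real_sequentially filterlim_at_top by blast
  ultimately have "\<forall>\<^sub>F n in sequentially. (\<forall>p \<in> r_patches T 0. finite (occ p n)) \<and> 2 * r \<le> real n"
    by (rule eventually_conj)
  then obtain n where n: "\<forall>p \<in> r_patches T 0. finite (occ p n)" "2 * r \<le> real n"
    using eventually_happens' sequentially_bot by blast
  \<comment> \<open>Every puncture carries some \<open>0\<close>-patch, so these finitely many
    finite sets of occurrences cover the ball.\<close>
  have "punctures T \<inter> cball 0 r \<subseteq> (\<Union>p \<in> r_patches T 0. occ p n)"
    using cball_subset_centred_cube[OF n(2)] unfolding occ_def r_patches_def by auto
  then show ?thesis
    using n(1) fin by (meson finite_UN finite_subset)
qed

lemma finite_ball_patch_shift:
  fixes T :: "'a::euclidean_space tile set"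
  assumes T: "punctured_tiling T" "finite_local_complexity T" "equidistributed_frequencies T"
  shows "finite (ball_patch r (shift T x))"
proof -
  define A where "A = {p \<in> T. snd p \<in> cball 0 (r + norm x)}"
  have "inj_on snd A"
    using inj_on_snd_tiling[OF T(1)] unfolding A_def by (auto intro: inj_on_subset)
  moreover have "snd ` A \<subseteq> punctures T \<inter> cball 0 (r + norm x)"
    unfolding A_def punctures_def by auto
  ultimately have "finite A"
    using finite_punctures_cball[OF T(2,3)] by (metis finite_imageD finite_subset)
  moreover have "ball_patch r (shift T x) \<subseteq> (\<lambda>(t, y). ((\<lambda>z. z - x) ` t, y - x)) ` A"
  proof
    fix q assume "q \<in> ball_patch r (shift T x)"
    then obtain t y where q: "q = ((\<lambda>z. z - x) ` t, y - x)" "(t, y) \<in> T" "norm (y - x) \<le> r"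
      unfolding ball_patch_def shift_def by auto
    then have "(t, y) \<in> A"
      using norm_triangle_sub[of y x] unfolding A_def by simp
    then show "q \<in> (\<lambda>(t, y). ((\<lambda>z. z - x) ` t, y - x)) ` A"
      using q(1) by force
  qed
  ultimately show ?thesis
    by (meson finite_imageI finite_subset)
qed

text \<open>Finitely many compact tiles have a compact union, which cannot be the whole
  space.\<close>

lemma infinite_tiling:
  fixes S :: "'a::euclidean_space tile set"
  assumes "punctured_tiling S"
  shows "infinite S"
proof
  assume "finite S"
  moreover have "\<forall>(t, x)\<in>S. compact t"
    using assms unfolding punctured_tiling_def by fast
  ultimately have "compact (\<Union>(t, x)\<in>S. t)"
    by (intro compact_UN) auto
  then have "compact (UNIV :: 'a set)"
    using assms unfolding punctured_tiling_def by metis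
  then show False
    using compact_imp_bounded not_bounded_UNIV by blast
qed

text \<open>
  A patch does not remember its radius. The radius is recovered from a larger patch that contains
  a puncture outside the ball of radius \<open>r\<close>.
\<close>

lemma ball_patch_discrete_tiling_space:
  fixes T :: "'a::euclidean_space tile set"
  assumes T: "punctured_tiling T" "finite_local_complexity T" "equidistributed_frequencies T"
    and S: "S \<in> discrete_tiling_space T" and r: "0 \<le> r"
  shows "ball_patch r S \<in> r_patches T r"
proof -
  have S': "punctured_tiling S" "all_patches S = all_patches T" "0 \<in> punctures S"
    using S unfolding discrete_tiling_space_def by auto
  have occurs: "\<exists>s'\<ge>0. \<exists>x\<in>punctures T. ball_patch s S = ball_patch s' (shift T x)" if s: "0 \<le> s" for s
  proof -
    have "ball_patch s S = ball_patch s (shift S 0)"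
      by simp
    then have "ball_patch s S \<in> all_patches S"
      using s S'(3) unfolding all_patches_def r_patches_def by blast
    then have "ball_patch s S \<in> all_patches T"
      unfolding S'(2) .
    then show ?thesis
      unfolding all_patches_def r_patches_def by auto
  qed
  \<comment> \<open>Otherwise \<open>S\<close> would coincide with its \<open>r\<close>-patch, which
    also occurs in \<open>T\<close> and is therefore finite.\<close>
  have "\<exists>(t, y)\<in>S. r < norm y"
  proof (rule ccontr)
    assume "\<not> (\<exists>(t, y)\<in>S. r < norm y)"
    then have "ball_patch r S = S"
      unfolding ball_patch_def by force
    then have "finite S"
      using occurs[OF r] finite_ball_patch_shift[OF T] by metis
    then show False
      using infinite_tiling S'(1) by blast
  qed
  then obtain t y where ty: "(t, y) \<in> S" "r < norm y"
    by blast
  obtain s' x where x: "x \<in> punctures T" "ball_patch (norm y) S = ball_patch s' (shift T x)"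
    using occurs[of "norm y"] by auto
  have "(t, y) \<in> ball_patch (norm y) S"
    using ty(1) by (simp add: mem_ball_patch)
  \<comment> \<open>The far puncture occurs in a patch of radius \<open>s'\<close>, so
    \<open>norm y\<close> is at most \<open>s'\<close>.\<close>
  then have "r \<le> s'"
    using ty(2) unfolding x(2) mem_ball_patch by simp
  have "ball_patch r S = ball_patch r (ball_patch (norm y) S)"
    using ty(2) by (simp add: ball_patch_ball_patch min_absorb1)
  also have "\<dots> = ball_patch r (shift T x)"
    unfolding x(2) using \<open>r \<le> s'\<close> by (simp add: ball_patch_ball_patch min_absorb1)
  finally show ?thesis
    using x(1) unfolding r_patches_def by blast
qed

section \<open>Counting the extensions of a patch by frequencies\<close>

lemma patch_count_pos:
  assumes "punctured_tiling T" "finite_local_complexity T" "0 \<le> r"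
  shows "0 < patch_count T r"
proof -
  have "T \<noteq> {}"
    using infinite_tiling[OF assms(1)] by auto
  then show ?thesis
    using assms(2,3)
    unfolding patch_count_def finite_local_complexity_def r_patches_def punctures_def
    by (simp add: card_gt_0_iff)
qed

text \<open>Occurrences of different \<open>q\<close> are disjoint, and each is an occurrence of
  \<open>p\<close>. Local finiteness ensures that \<open>card\<close> really counts them.\<close>

lemma patch_density_sum_le:
  fixes T :: "'a::euclidean_space tile set"
  assumes T: "finite_local_complexity T" "equidistributed_frequencies T"
    and rs: "r \<le> s" and Q: "finite Q" "\<And>q. q \<in> Q \<Longrightarrow> ball_patch r q = p"
  shows "(\<Sum>q\<in>Q. patch_density T s q n) \<le> patch_density T r p n"
proof -
  define occ where "occ r p = {x \<in> punctures T \<inter> centred_cube (real n). ball_patch r (shift T x) = p}"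
    for r p
  obtain R where "centred_cube (real n) \<subseteq> cball (0::'a) R"
    unfolding centred_cube_def using bounded_subset_ballD[OF bounded_cbox] ball_subset_cball
    by (metis order_trans)
  then have "finite (punctures T \<inter> centred_cube (real n))"
    using finite_punctures_cball[OF T, of R] by (meson Int_mono finite_subset order_refl)
  then have fin: "finite (occ r p)" for r p
    unfolding occ_def by (rule finite_subset[rotated]) auto
  have "(\<Union>q\<in>Q. occ s q) \<subseteq> occ r p"
  proof
    fix x assume "x \<in> (\<Union>q\<in>Q. occ s q)"
    then have x: "x \<in> punctures T \<inter> centred_cube (real n)" "ball_patch s (shift T x) \<in> Q"
      unfolding occ_def by auto
    have "ball_patch r (shift T x) = ball_patch r (ball_patch s (shift T x))"
      using rs by (simp add: ball_patch_ball_patch min_absorb1)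
    then show "x \<in> occ r p"
      using x Q(2) unfolding occ_def by simp
  qed
  then have "card (\<Union>q\<in>Q. occ s q) \<le> card (occ r p)"
    using fin card_mono by blast
  moreover have "card (\<Union>q\<in>Q. occ s q) = (\<Sum>q\<in>Q. card (occ s q))"
    using Q(1) fin by (intro card_UN_disjoint) (auto simp: occ_def)
  ultimately have "(\<Sum>q\<in>Q. real (card (occ s q))) \<le> real (card (occ r p))"
    by (metis of_nat_le_iff of_nat_sum)
  then show ?thesis
    unfolding patch_density_def occ_def[symmetric] sum_divide_distrib[symmetric]
    by (rule divide_right_mono) simp
qed

lemma card_extending_patches_le:
  fixes T :: "'a::euclidean_space tile set"
  assumes T: "punctured_tiling T" "finite_local_complexity T" "equidistributed_frequencies T"
  shows "\<exists>B>0. \<forall>r\<ge>0. \<forall>s\<ge>r. \<forall>p\<in>r_patches T r.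
    real (card {q \<in> r_patches T s. ball_patch r q = p})
      \<le> B * (real (patch_count T s) / real (patch_count T r))"
proof -
  obtain c C where cC: "0 < c" "0 < C" and
    freq: "\<And>r p. \<lbrakk>0 \<le> r; p \<in> r_patches T r\<rbrakk> \<Longrightarrow>
      c / real (patch_count T r) \<le> lim (patch_density T r p) \<and>
      lim (patch_density T r p) \<le> C / real (patch_count T r)"
    using T(3) unfolding equidistributed_frequencies_def by metis
  have lim: "patch_density T r p \<longlonglongrightarrow> lim (patch_density T r p)"
    if "0 \<le> r" "p \<in> r_patches T r" for r p
    using T(3) that unfolding equidistributed_frequencies_def by (simp add: convergent_LIMSEQ_iff)
  have "real (card {q \<in> r_patches T s. ball_patch r q = p})
        \<le> C / c * (real (patch_count T s) / real (patch_count T r))"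
    if r: "0 \<le> r" and s: "r \<le> s" and p: "p \<in> r_patches T r" for r s p
  proof -
    define Q where "Q = {q \<in> r_patches T s. ball_patch r q = p}"
    have "finite Q"
      using T(2) r s unfolding Q_def finite_local_complexity_def by simp
    have P: "0 < real (patch_count T s)" "0 < real (patch_count T r)"
      using patch_count_pos[OF T(1,2)] r s by auto
    have "(\<Sum>q\<in>Q. lim (patch_density T s q)) \<le> lim (patch_density T r p)"
    proof (rule tendsto_le[OF sequentially_bot])
      show "patch_density T r p \<longlonglongrightarrow> lim (patch_density T r p)"
        by (rule lim[OF r p])
      show "(\<lambda>n. \<Sum>q\<in>Q. patch_density T s q n) \<longlonglongrightarrow> (\<Sum>q\<in>Q. lim (patch_density T s q))"
        using r s lim unfolding Q_def by (intro tendsto_sum) auto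
      show "\<forall>\<^sub>F n in sequentially. (\<Sum>q\<in>Q. patch_density T s q n) \<le> patch_density T r p n"
        using patch_density_sum_le[OF T(2,3) s \<open>finite Q\<close>] unfolding Q_def
        by (intro always_eventually allI) auto
    qed
    moreover have "real (card Q) * (c / real (patch_count T s)) \<le> (\<Sum>q\<in>Q. lim (patch_density T s q))"
      using freq r s unfolding Q_def by (intro sum_bounded_below) auto
    ultimately have "real (card Q) * (c / real (patch_count T s)) \<le> C / real (patch_count T r)"
      using freq[OF r p] by linarith
    then show ?thesis
      using P cC unfolding Q_def[symmetric] by (simp add: field_simps)
  qed
  then show ?thesis
    using cC by (intro exI[of _ "C / c"]) simp
qed

text \<open>The scale factor needed for halving \<open>\<delta>\<close> may be larger than 4; powers
  of 4 reach it. The absolute value keeps the factor nonnegative, so that the inequalities can be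
  multiplied.\<close>

lemma patch_count_power_le:
  assumes "\<forall>\<^sub>F r in at_top. real (patch_count T (4 * r)) \<le> c * real (patch_count T r)"
  shows "\<forall>\<^sub>F r in at_top. real (patch_count T (4 ^ k * r)) \<le> \<bar>c\<bar> ^ k * real (patch_count T r)"
proof (induction k)
  case (Suc k)
  have "filterlim (\<lambda>r::real. 4 ^ k * r) at_top at_top"
    by (rule filterlim_tendsto_pos_mult_at_top[OF tendsto_const _ filterlim_ident]) simp
  then have "\<forall>\<^sub>F r in at_top. real (patch_count T (4 * (4 ^ k * r))) \<le> c * real (patch_count T (4 ^ k * r))"
    using assms filterlim_iff by fastforce
  then show ?case
    using Suc.IH
  proof eventually_elim
    case (elim r)
    have "real (patch_count T (4 ^ Suc k * r)) \<le> c * real (patch_count T (4 ^ k * r))"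
      using elim(1) by (simp add: mult.assoc)
    also have "\<dots> \<le> \<bar>c\<bar> * real (patch_count T (4 ^ k * r))"
      by (intro mult_right_mono) auto
    also have "\<dots> \<le> \<bar>c\<bar> * (\<bar>c\<bar> ^ k * real (patch_count T r))"
      by (intro mult_left_mono elim(2)) auto
    finally show ?case
      by simp
  qed
qed simp

section \<open>The ultrametric of the discrete tiling space\<close>

locale tiling_scale =
  fixes \<delta> :: "real \<Rightarrow> real"
  assumes delta_pos: "0 \<le> r \<Longrightarrow> 0 < \<delta> r"
    and delta_antimono: "strict_antimono_on {0..} \<delta>"
    and delta_tendsto_0: "(\<delta> \<longlongrightarrow> 0) at_top"
begin

text \<open>This is an initial segment of the nonnegative reals, possibly empty, as tilings may
  already differ at radius 0. The proofs of the metric properties compare such sets by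
  inclusion.\<close>

definition agreement :: "'a::euclidean_space tile set \<Rightarrow> 'a tile set \<Rightarrow> real set" where
  "agreement S S' = {r. 0 \<le> r \<and> ball_patch r S = ball_patch r S'}"

lemma tiling_dist_eq:
  "tiling_dist \<delta> S S' = (if S = S' then 0 else if agreement S S' = {} then \<delta> 0 else Inf (\<delta> ` agreement S S'))"
  unfolding tiling_dist_def agreement_def by (simp add: Let_def)

lemma bdd_below_delta: "bdd_below (\<delta> ` agreement S S')"
  by (rule bdd_belowI[of _ 0]) (auto simp: agreement_def less_imp_le delta_pos)

lemma delta_mono: "\<lbrakk>0 \<le> r; r \<le> s\<rbrakk> \<Longrightarrow> \<delta> s \<le> \<delta> r"
  using delta_antimono unfolding monotone_on_def
  by (metis atLeast_iff dual_order.strict_iff_order order.trans order_refl)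

lemma agreement_down: "\<lbrakk>s \<in> agreement S S'; 0 \<le> r; r \<le> s\<rbrakk> \<Longrightarrow> r \<in> agreement S S'"
  unfolding agreement_def using ball_patch_eq_mono by blast

lemma tiling_dist_nonneg: "0 \<le> tiling_dist \<delta> S S'"
  unfolding tiling_dist_eq
  by (auto intro!: cInf_greatest simp: agreement_def less_imp_le delta_pos)

lemma tiling_dist_le:
  assumes "r \<in> agreement S S'"
  shows "tiling_dist \<delta> S S' \<le> \<delta> r"
  using assms cInf_lower[OF _ bdd_below_delta] delta_pos[of r] unfolding tiling_dist_eq agreement_def
  by (auto simp: less_imp_le)

text \<open>All radii of agreement are at most \<open>r\<close>, where \<open>\<delta>\<close> is at
  least \<open>\<delta> r\<close>; the default value \<open>\<delta> 0\<close> is too.\<close>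

lemma tiling_dist_ge:
  assumes "0 \<le> r" "r \<notin> agreement S S'"
  shows "\<delta> r \<le> tiling_dist \<delta> S S'"
proof -
  have "S \<noteq> S'"
    using assms unfolding agreement_def by auto
  moreover have "\<delta> r \<le> Inf (\<delta> ` agreement S S')" if "agreement S S' \<noteq> {}"
  proof (rule cInf_greatest)
    fix t assume "t \<in> \<delta> ` agreement S S'"
    then obtain s where s: "s \<in> agreement S S'" "t = \<delta> s"
      by blast
    then have "s \<le> r" "0 \<le> s"
      using assms agreement_down[of s S S' r] unfolding agreement_def by force+
    then show "\<delta> r \<le> t"
      using s delta_mono by simp
  qed (use that in simp)
  ultimately show ?thesis
    unfolding tiling_dist_eq using delta_mono assms(1) by auto
qed

lemma tiling_dist_mono:
  assumes "S1 \<noteq> S1'" "agreement S1 S1' \<subseteq> agreement S2 S2'"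
  shows "tiling_dist \<delta> S2 S2' \<le> tiling_dist \<delta> S1 S1'"
proof (cases "S2 = S2'")
  case True
  then show ?thesis
    using tiling_dist_nonneg by (simp add: tiling_dist_eq[of S2' S2'])
next
  case False
  show ?thesis
  proof (cases "agreement S1 S1' = {}")
    case True
    have "tiling_dist \<delta> S2 S2' \<le> \<delta> 0"
    proof (cases "agreement S2 S2' = {}")
      case False
      then have "0 \<in> agreement S2 S2'"
        using agreement_down[of _ S2 S2' 0] unfolding agreement_def by auto
      then show ?thesis
        by (rule tiling_dist_le)
    qed (use \<open>S2 \<noteq> S2'\<close> in \<open>simp add: tiling_dist_eq\<close>)
    then show ?thesis
      using True assms(1) by (simp add: tiling_dist_eq[of S1])
  next
    case False
    then show ?thesis
      using assms \<open>S2 \<noteq> S2'\<close> cInf_superset_mono[OF _ bdd_below_delta[of S2 S2'], of "\<delta> ` agreement S1 S1'"]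
      by (auto simp: tiling_dist_eq image_mono)
  qed
qed

text \<open>Initial segments of the nonnegative reals are nested.\<close>

lemma agreement_linear: "agreement S1 S1' \<subseteq> agreement S2 S2' \<or> agreement S2 S2' \<subseteq> agreement S1 S1'"
proof (rule ccontr)
  assume "\<not> ?thesis"
  then obtain r s where "r \<in> agreement S1 S1'" "r \<notin> agreement S2 S2'"
    "s \<in> agreement S2 S2'" "s \<notin> agreement S1 S1'"
    by blast
  then show False
    using agreement_down[of r S1 S1' s] agreement_down[of s S2 S2' r]
    unfolding agreement_def by force
qed

lemma ex_disagreement:
  assumes "S \<noteq> S'"
  shows "\<exists>r\<ge>0. r \<notin> agreement S S'"
proof -
  obtain r where "0 \<le> r" "ball_patch r S \<noteq> ball_patch r S'"
    using tilings_differ_on_ball[OF assms] .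
  then show ?thesis
    by (intro exI[of _ r]) (simp add: agreement_def)
qed

lemma tiling_dist_pos:
  assumes "S \<noteq> S'"
  shows "0 < tiling_dist \<delta> S S'"
proof -
  obtain r where r: "0 \<le> r" "r \<notin> agreement S S'"
    using ex_disagreement[OF assms] by blast
  then have "\<delta> r \<le> tiling_dist \<delta> S S'"
    by (rule tiling_dist_ge)
  then show ?thesis
    using delta_pos[OF r(1)] by linarith
qed

lemma tiling_dist_commute: "tiling_dist \<delta> S S' = tiling_dist \<delta> S' S"
proof -
  have "agreement S S' = agreement S' S"
    unfolding agreement_def by auto
  then show ?thesis
    unfolding tiling_dist_eq by auto
qed

text \<open>Agreement is transitive at each radius, and of two nested agreement sets the smaller one
  is their intersection.\<close>

lemma tiling_dist_ultra: "tiling_dist \<delta> S1 S3 \<le> max (tiling_dist \<delta> S1 S2) (tiling_dist \<delta> S2 S3)"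
proof (cases "S1 = S2 \<or> S2 = S3")
  case False
  have sub: "agreement S1 S2 \<inter> agreement S2 S3 \<subseteq> agreement S1 S3"
    unfolding agreement_def by auto
  show ?thesis
    using agreement_linear[of S1 S2 S2 S3]
  proof
    assume "agreement S1 S2 \<subseteq> agreement S2 S3"
    then have "tiling_dist \<delta> S1 S3 \<le> tiling_dist \<delta> S1 S2"
      using False sub by (intro tiling_dist_mono) auto
    then show ?thesis
      by simp
  next
    assume "agreement S2 S3 \<subseteq> agreement S1 S2"
    then have "tiling_dist \<delta> S1 S3 \<le> tiling_dist \<delta> S2 S3"
      using False sub by (intro tiling_dist_mono) auto
    then show ?thesis
      by simp
  qed
qed (auto simp: le_max_iff_disj)

text \<open>Patches are themselves sets of tiles, so \<^const>\<open>tiling_dist\<close> can be evaluated on them.\<close>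

lemma tiling_dist_ball_patch:
  assumes "0 \<le> s" "s \<notin> agreement S S'"
  shows "tiling_dist \<delta> (ball_patch s S) (ball_patch s S') = tiling_dist \<delta> S S'"
proof -
  have ne: "ball_patch s S \<noteq> ball_patch s S'"
    using assms unfolding agreement_def by simp
  have "r \<in> agreement (ball_patch s S) (ball_patch s S') \<longleftrightarrow> r \<in> agreement S S'" for r
  proof (cases "r \<le> s")
    case True
    then show ?thesis
      unfolding agreement_def by (simp add: ball_patch_ball_patch min_absorb1)
  next
    case False
    \<comment> \<open>Beyond radius \<open>s\<close> the cut patches no longer change, and they
      still differ.\<close>
    then have "r \<notin> agreement S S'"
      using assms agreement_down[of r S S' s] by auto
    then show ?thesis
      using False ne unfolding agreement_def by (simp add: ball_patch_ball_patch min_absorb2)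
  qed
  then have "agreement (ball_patch s S) (ball_patch s S') = agreement S S'"
    by blast
  then show ?thesis
    using ne unfolding tiling_dist_eq by auto
qed

lemma levelled_ultrametric_tiling_space:
  fixes T :: "'a::euclidean_space tile set"
  assumes T: "punctured_tiling T" "finite_local_complexity T" "equidistributed_frequencies T"
  shows "levelled_ultrametric (discrete_tiling_space T) (tiling_dist \<delta>)"
proof
  fix S S' S'' :: "'a tile set"
  show "0 \<le> tiling_dist \<delta> S S'"
    by (rule tiling_dist_nonneg)
  show "tiling_dist \<delta> S S' = tiling_dist \<delta> S' S"
    by (rule tiling_dist_commute)
  show "(tiling_dist \<delta> S S' = 0) = (S = S')"
    using tiling_dist_pos[of S S'] by (cases "S = S'") (simp_all add: tiling_dist_eq[of S' S'])
  show ultra: "tiling_dist \<delta> S S'' \<le> max (tiling_dist \<delta> S S') (tiling_dist \<delta> S' S'')"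
    by (rule tiling_dist_ultra)
  then show "tiling_dist \<delta> S S'' \<le> tiling_dist \<delta> S S' + tiling_dist \<delta> S' S''"
    using tiling_dist_nonneg[of S S'] tiling_dist_nonneg[of S' S''] by linarith
next
  fix \<epsilon> :: real assume "0 < \<epsilon>"
  have "\<forall>\<^sub>F r in at_top. \<delta> r < \<epsilon> \<and> 0 \<le> r"
    using order_tendstoD(2)[OF delta_tendsto_0 \<open>0 < \<epsilon>\<close>] eventually_ge_at_top[of 0]
    by (rule eventually_conj)
  \<comment> \<open>Tilings more than \<open>\<epsilon>\<close> apart differ at radius
    \<open>s\<close>, so their distance can be read off from their \<open>s\<close>-patches, of
    which there are finitely many.\<close>
  then obtain s where s: "\<delta> s < \<epsilon>" "0 \<le> s"
    using eventually_happens' trivial_limit_at_top_linorder by blast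
  let ?V = "{t \<in> dist_values (discrete_tiling_space T) (tiling_dist \<delta>). \<epsilon> < t}"
  have "?V \<subseteq> (\<lambda>(p, q). tiling_dist \<delta> p q) ` (r_patches T s \<times> r_patches T s)"
  proof
    fix t assume "t \<in> ?V"
    then obtain S S' where S: "S \<in> discrete_tiling_space T" "S' \<in> discrete_tiling_space T"
      and t: "t = tiling_dist \<delta> S S'" "\<epsilon> < t"
      unfolding dist_values_def by auto
    have "s \<notin> agreement S S'"
      using tiling_dist_le[of s S S'] s t by linarith
    then have "t = tiling_dist \<delta> (ball_patch s S) (ball_patch s S')"
      using tiling_dist_ball_patch s(2) t(1) by metis
    then show "t \<in> (\<lambda>(p, q). tiling_dist \<delta> p q) ` (r_patches T s \<times> r_patches T s)"
      using ball_patch_discrete_tiling_space[OF T _ s(2)] S by (auto simp: image_iff)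
  qed
  moreover have "finite (r_patches T s)"
    using T(2) s(2) unfolding finite_local_complexity_def by blast
  ultimately show "finite ?V"
    by (meson finite_SigmaI finite_imageI finite_subset)
qed

end

section \<open>Summing the distances from a point\<close>

context tiling_scale
begin

text \<open>Since \<open>x\<close> and \<open>w\<close> differ by radius \<open>s\<close>, the
  \<open>s\<close>-patch of \<open>w\<close> determines its distance from \<open>x\<close>, and
  these distances are distinct on \<open>W\<close>.\<close>

lemma inj_on_ball_patch:
  assumes "inj_on (tiling_dist \<delta> x) W" "0 \<le> s" "\<And>w. w \<in> W \<Longrightarrow> s \<notin> agreement x w"
  shows "inj_on (ball_patch s) W"
proof (rule inj_onI)
  fix v w assume *: "v \<in> W" "w \<in> W" "ball_patch s v = ball_patch s w"
  then have "tiling_dist \<delta> x v = tiling_dist \<delta> x w"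
    using assms(2,3) tiling_dist_ball_patch by metis
  then show "v = w"
    using assms(1) * by (simp add: inj_on_eq_iff)
qed

text \<open>The set \<open>Q\<close> is left open: it will be the set of all
  \<open>s\<close>-patches, or of those extending a given smaller patch.\<close>

lemma card_separated_le:
  fixes T :: "'a::euclidean_space tile set"
  assumes T: "punctured_tiling T" "finite_local_complexity T" "equidistributed_frequencies T"
    and W: "W \<subseteq> discrete_tiling_space T" "inj_on (tiling_dist \<delta> x) W"
    and s: "0 \<le> s" "\<And>w. w \<in> W \<Longrightarrow> s \<notin> agreement x w"
    and Q: "finite Q" "\<And>w. \<lbrakk>w \<in> W; ball_patch s w \<in> r_patches T s\<rbrakk> \<Longrightarrow> ball_patch s w \<in> Q"
  shows "card W \<le> card Q"
proof (rule card_inj_on_le[OF _ _ Q(1)])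
  show "inj_on (ball_patch s) W"
    by (rule inj_on_ball_patch[OF W(2) s])
  show "ball_patch s ` W \<subseteq> Q"
    using ball_patch_discrete_tiling_space[OF T _ s(1)] W(1) Q(2) by blast
qed

text \<open>
  Each point separating from \<open>x\<close> at a scale between \<open>r\<close> and \<open>a * r\<close> extends the \<open>r\<close>-patch of \<open>x\<close>
  to its own \<open>a * r\<close>-patch. The doubling condition on the patch count bounds their number
  independently of \<open>r\<close>, and \<open>\<delta> a \<le> 1/2\<close> then makes the sum over all scales geometric.
\<close>

lemma sum_dist_values_le:
  fixes T :: "'a::euclidean_space tile set"
  assumes T: "punctured_tiling T" "finite_local_complexity T" "equidistributed_frequencies T"
    and growth: "\<forall>\<^sub>F r in at_top. real (patch_count T (4 * r)) \<le> c * real (patch_count T r)"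
    and submult: "\<forall>a\<ge>R. \<forall>r\<ge>R. \<delta> (a * r) \<le> \<delta> a * \<delta> r"
  shows "\<exists>K\<ge>0. \<forall>x \<in> discrete_tiling_space T. \<forall>y \<in> discrete_tiling_space T.
    \<forall>V \<subseteq> tiling_dist \<delta> x ` discrete_tiling_space T.
      finite V \<longrightarrow> (\<forall>v\<in>V. 0 < v \<and> v < tiling_dist \<delta> x y) \<longrightarrow> \<Sum>V \<le> K * tiling_dist \<delta> x y"
proof -
  let ?X = "discrete_tiling_space T" and ?d = "tiling_dist \<delta>"
  \<comment> \<open>A power of 4 is taken for \<open>a\<close>, so that the growth condition
    iterates to it; it is large enough to halve \<open>\<delta>\<close>.\<close>
  obtain a G where a: "1 < a" "R \<le> a" "\<delta> a \<le> 1 / 2" and G: "0 \<le> G"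
    "\<forall>\<^sub>F r in at_top. real (patch_count T (a * r)) \<le> G * real (patch_count T r)"
  proof -
    have "\<forall>\<^sub>F a in at_top. \<delta> a < 1 / 2 \<and> 1 < a \<and> R \<le> a"
      using order_tendstoD(2)[OF delta_tendsto_0, of "1 / 2"]
      by (intro eventually_conj eventually_gt_at_top eventually_ge_at_top) simp
    then obtain a0 where a0: "\<And>a. a0 \<le> a \<Longrightarrow> \<delta> a < 1 / 2 \<and> 1 < a \<and> R \<le> a"
      unfolding eventually_at_top_linorder by blast
    obtain k where "a0 < (4::real) ^ k"
      using real_arch_pow[of 4 a0] by auto
    then show ?thesis
      using that[of "4 ^ k" "\<bar>c\<bar> ^ k"] a0[of "4 ^ k"] patch_count_power_le[OF growth, of k] by simp
  qed
  obtain R0 where R0: "1 \<le> R0" "R \<le> R0"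
    "\<And>r. R0 \<le> r \<Longrightarrow> real (patch_count T (a * r)) \<le> G * real (patch_count T r)"
  proof -
    obtain r0 where "\<And>r. r0 \<le> r \<Longrightarrow> real (patch_count T (a * r)) \<le> G * real (patch_count T r)"
      using G(2) unfolding eventually_at_top_linorder by blast
    then show ?thesis
      using that[of "max r0 (max 1 R)"] by simp
  qed
  obtain B where B: "0 < B" "\<And>r s p. \<lbrakk>0 \<le> r; r \<le> s; p \<in> r_patches T r\<rbrakk>
      \<Longrightarrow> real (card {q \<in> r_patches T s. ball_patch r q = p})
        \<le> B * (real (patch_count T s) / real (patch_count T r))"
    using card_extending_patches_le[OF T] by blast
  \<comment> \<open>\<open>K1\<close> bounds the number of distances arising between
    \<open>r\<close> and \<open>a * r\<close> for \<open>r \<ge> R0\<close>; \<open>K2\<close> also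
    allows for points already separated at radius \<open>R0\<close>, whose \<open>R0\<close>-patches
    are distinct.\<close>
  define K1 where "K1 = B * G"
  define K2 where "K2 = K1 + real (patch_count T R0)"
  have K1: "0 \<le> K1"
    unfolding K1_def using B G by simp
  then have K2: "0 \<le> K2" "K1 \<le> K2" "real (patch_count T R0) \<le> K2"
    unfolding K2_def by auto
  have count: "real (card W) \<le> K1"
    if x: "x \<in> ?X" and W: "W \<subseteq> ?X" "inj_on (?d x) W" and r: "R0 \<le> r"
      and w: "\<And>w. w \<in> W \<Longrightarrow> r \<in> agreement x w \<and> a * r \<notin> agreement x w" for x W r
  proof -
    have r': "0 \<le> r" "r \<le> a * r" "0 \<le> a * r"
      using r R0(1) a(1) by (auto simp: mult_le_cancel_right1)
    define Q where "Q = {q \<in> r_patches T (a * r). ball_patch r q = ball_patch r x}"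
    have "finite Q"
      using T(2) r'(3) unfolding Q_def finite_local_complexity_def by simp
    moreover have "ball_patch (a * r) w \<in> Q" if "w \<in> W" "ball_patch (a * r) w \<in> r_patches T (a * r)" for w
      using that w[OF that(1)] r'(2) unfolding Q_def agreement_def
      by (simp add: ball_patch_ball_patch min_absorb1)
    ultimately have "real (card W) \<le> real (card Q)"
      using card_separated_le[OF T W r'(3)] w by (metis of_nat_le_iff)
    also have "\<dots> \<le> B * (real (patch_count T (a * r)) / real (patch_count T r))"
      unfolding Q_def by (intro B(2) ball_patch_discrete_tiling_space[OF T x] r')
    also have "\<dots> \<le> B * G"
      using R0(3)[OF r] patch_count_pos[OF T(1,2) r'(1)] B(1) by (simp add: divide_le_eq)
    finally show ?thesis
      unfolding K1_def .
  qed
  have "\<Sum>V \<le> (K2 + 2 * K1) * ?d x y"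
    if x: "x \<in> ?X" and y: "y \<in> ?X" and V: "finite V" "V \<subseteq> ?d x ` ?X"
      "\<And>v. v \<in> V \<Longrightarrow> 0 < v \<and> v < ?d x y" for x y V
  proof (cases "x = y")
    case True
    then have "V = {}"
      using V(3) by (force simp: tiling_dist_eq)
    then show ?thesis
      using K1 K2(1) tiling_dist_nonneg[of x y] by (simp add: mult_nonneg_nonneg)
  next
    case False
    \<comment> \<open>One point of the space is picked for each distance in
      \<open>V\<close>.\<close>
    obtain W where W: "W \<subseteq> ?X" "inj_on (?d x) W" "V = ?d x ` W"
      using V(2) unfolding subset_image_inj by blast
    then have finW: "finite W"
      using V(1) finite_imageD by blast
    have ne: "x \<noteq> w" if "w \<in> W" for w
      using V(3)[of "?d x w"] that W(3) by (auto simp: tiling_dist_eq)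
    have agr: "agreement x y \<subseteq> agreement x w" if "w \<in> W" for w
      using agreement_linear[of x y x w] tiling_dist_mono[OF ne[OF that], of x y] V(3)[of "?d x w"]
        that W(3) by force
    have sub: "{w \<in> W. P w} \<subseteq> ?X" "inj_on (?d x) {w \<in> W. P w}" for P
      using W(1,2) by (auto intro: inj_on_subset)
    \<comment> \<open>At radius \<open>t\<close>, \<open>x\<close> and \<open>y\<close> already
      differ, so \<open>\<delta> t\<close> is at most their distance and can start the geometric
      series; yet only boundedly many points of \<open>W\<close> have separated from
      \<open>x\<close>.\<close>
    obtain t where t: "R0 \<le> t" "t \<notin> agreement x y" "real (card {w \<in> W. t \<notin> agreement x w}) \<le> K2"
    proof (cases "R0 \<in> agreement x y")
      case False
      have "card {w \<in> W. R0 \<notin> agreement x w} \<le> card (r_patches T R0)"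
        by (rule card_separated_le[OF T sub]) (use R0(1) T(2) in \<open>auto simp: finite_local_complexity_def\<close>)
      then show ?thesis
        using that[of R0] False K2(3) unfolding patch_count_def by linarith
    next
      case True
      obtain r0 where r0: "0 \<le> r0" "r0 \<notin> agreement x y"
        using ex_disagreement[OF False] by blast
      obtain n where "r0 < a ^ n"
        using real_arch_pow[OF a(1)] by blast
      moreover have "a ^ n * 1 \<le> a ^ n * R0"
        using R0(1) a(1) by (intro mult_left_mono) auto
      ultimately have "r0 \<le> a ^ n * R0"
        by linarith
      then have "a ^ n * R0 \<notin> agreement x y"
        using r0 agreement_down by blast
      \<comment> \<open>This is the first scale past the agreement of \<open>x\<close> with
        \<open>y\<close>. At the previous scale \<open>x\<close> still agrees with \<open>y\<close>,
        hence with every \<open>w\<close>, so all separations up to this radius happen within one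
        scale.\<close>
      then obtain k where k: "\<forall>i<k. a ^ i * R0 \<in> agreement x y" "a ^ k * R0 \<notin> agreement x y"
        using ex_least_nat_le[of "\<lambda>n. a ^ n * R0 \<notin> agreement x y" n] by blast
      then obtain i where i: "k = Suc i"
        using True by (cases k) auto
      define r where "r = a ^ i * R0"
      have r: "r \<in> agreement x y" "a * r \<notin> agreement x y"
        using k unfolding i r_def by (auto simp: mult.assoc)
      have "R0 \<le> r"
        using one_le_power[of a i] a(1) R0(1) unfolding r_def by (simp add: mult_le_cancel_right1)
      then have "real (card {w \<in> W. a * r \<notin> agreement x w}) \<le> K1"
        using r(1) agr by (intro count[OF x sub]) auto
      moreover have "R0 \<le> a * r"
        using \<open>R0 \<le> r\<close> a(1) R0(1) mult_right_mono[of 1 a r] by linarith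
      ultimately show ?thesis
        using that[of "a * r"] r(2) K2(2) by linarith
    qed
    have scale: "R0 \<le> a ^ j * t" "0 \<le> a ^ j * t" "a ^ j * t \<le> a ^ Suc j * t" for j
    proof -
      have "1 \<le> a ^ j"
        using a(1) by simp
      then have "1 * t \<le> a ^ j * t"
        using t(1) R0(1) by (intro mult_right_mono) auto
      then show "R0 \<le> a ^ j * t" "0 \<le> a ^ j * t"
        using t(1) R0(1) by linarith+
      then show "a ^ j * t \<le> a ^ Suc j * t"
        using a(1) mult_right_mono[of 1 a "a ^ j * t"] by (simp add: mult.assoc)
    qed
    have decay: "\<delta> (a ^ j * t) \<le> (1 / 2) ^ j * ?d x y" for j
    proof (induction j)
      case 0
      show ?case
        using tiling_dist_ge[of t x y] t R0(1) by simp
    next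
      case (Suc j)
      have "\<delta> (a ^ Suc j * t) \<le> \<delta> a * \<delta> (a ^ j * t)"
        using submult a(2) scale(1)[of j] R0(2) by (simp add: mult.assoc)
      also have "\<dots> \<le> 1 / 2 * ((1 / 2) ^ j * ?d x y)"
        using a(3) Suc.IH delta_pos[OF scale(2)[of j]] by (intro mult_mono) auto
      finally show ?case
        by simp
    qed
    \<comment> \<open>The term \<open>2 - 2 * (1 / 2) ^ j\<close> is the sum of
      \<open>(1 / 2) ^ i\<close> over \<open>i < j\<close>: passing from scale \<open>j\<close> to
      the next adds at most \<open>K1\<close> points, each at distance at most
      \<open>\<delta> (a ^ j * t)\<close>.\<close>
    have partial: "(\<Sum>w | w \<in> W \<and> a ^ j * t \<notin> agreement x w. ?d x w)
        \<le> (K2 + K1 * (2 - 2 * (1 / 2) ^ j)) * ?d x y" for j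
    proof (induction j)
      case 0
      have "(\<Sum>w | w \<in> W \<and> t \<notin> agreement x w. ?d x w)
          \<le> real (card {w \<in> W. t \<notin> agreement x w}) * ?d x y"
        using V(3) W(3) by (intro sum_bounded_above) (auto simp: less_imp_le)
      also have "\<dots> \<le> K2 * ?d x y"
        by (intro mult_right_mono t(3) tiling_dist_nonneg)
      finally show ?case
        by simp
    next
      case (Suc j)
      define N where "N = {w \<in> W. a ^ j * t \<in> agreement x w \<and> a ^ Suc j * t \<notin> agreement x w}"
      have split: "{w \<in> W. a ^ Suc j * t \<notin> agreement x w} = {w \<in> W. a ^ j * t \<notin> agreement x w} \<union> N"
        using agreement_down[OF _ scale(2,3)] unfolding N_def by blast
      have "real (card N) \<le> K1"
        unfolding N_def by (rule count[OF x sub scale(1)[of j]]) (auto simp: mult.assoc)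
      then have "real (card N) * ((1 / 2) ^ j * ?d x y) \<le> K1 * ((1 / 2) ^ j * ?d x y)"
        by (intro mult_right_mono mult_nonneg_nonneg tiling_dist_nonneg) auto
      moreover have "(\<Sum>w\<in>N. ?d x w) \<le> real (card N) * ((1 / 2) ^ j * ?d x y)"
        using tiling_dist_le decay[of j] unfolding N_def
        by (intro sum_bounded_above) (auto intro: order_trans)
      moreover have "(\<Sum>w | w \<in> W \<and> a ^ Suc j * t \<notin> agreement x w. ?d x w)
          = (\<Sum>w | w \<in> W \<and> a ^ j * t \<notin> agreement x w. ?d x w) + (\<Sum>w\<in>N. ?d x w)"
        unfolding split using finW by (intro sum.union_disjoint) (auto simp: N_def)
      ultimately show ?case
        using Suc.IH by (simp add: algebra_simps)
    qed
    \<comment> \<open>The sum of these nonnegative radii bounds each of them, so some power of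
      \<open>a\<close> gives a scale at which all of \<open>W\<close> has separated from
      \<open>x\<close>.\<close>
    obtain \<rho> where \<rho>: "\<And>w. w \<in> W \<Longrightarrow> 0 \<le> \<rho> w \<and> \<rho> w \<notin> agreement x w"
      using ex_disagreement[OF ne] by metis
    obtain j where "sum \<rho> W < a ^ j"
      using real_arch_pow[OF a(1)] by blast
    moreover have "a ^ j * 1 \<le> a ^ j * t"
      using t(1) R0(1) a(1) by (intro mult_left_mono) auto
    ultimately have j: "sum \<rho> W \<le> a ^ j * t"
      by linarith
    have "a ^ j * t \<notin> agreement x w" if "w \<in> W" for w
    proof -
      have "\<rho> w \<le> sum \<rho> W"
        using \<rho> by (intro member_le_sum[OF that _ finW]) auto
      then have "\<rho> w \<le> a ^ j * t"
        using j by linarith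
      then show ?thesis
        using agreement_down[of "a ^ j * t" x w "\<rho> w"] \<rho>[OF that] by blast
    qed
    then have "{w \<in> W. a ^ j * t \<notin> agreement x w} = W"
      by blast
    then have "\<Sum>V \<le> (K2 + K1 * (2 - 2 * (1 / 2) ^ j)) * ?d x y"
      using partial[of j] W(2,3) by (simp add: sum.reindex)
    also have "\<dots> \<le> (K2 + 2 * K1) * ?d x y"
      using K1 tiling_dist_nonneg by (intro mult_right_mono) (auto simp: algebra_simps)
    finally show ?thesis .
  qed
  then show ?thesis
    using K1 K2 by (intro exI[of _ "K2 + 2 * K1"]) simp
qed

end

theorem theorem4p16:
  fixes T :: "'a::euclidean_space tile set" and \<delta> :: "real \<Rightarrow> real"
  assumes "punctured_tiling T"
    and "finite_local_complexity T"
    and "equidistributed_frequencies T"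
    and "\<exists>c::real. \<forall>\<^sub>F r in at_top. real (patch_count T (4 * r)) \<le> c * real (patch_count T r)"
    and "\<forall>r\<ge>0. 0 < \<delta> r"
    and "strict_antimono_on {0..} \<delta>"
    and "(\<delta> \<longlongrightarrow> 0) at_top"
    and "set_integrable lborel {1..} (\<lambda>x. \<delta> x / x)"
    and "\<exists>R. \<forall>a\<ge>R. \<forall>r\<ge>R. \<delta> (a * r) \<le> \<delta> a * \<delta> r"
  shows "\<exists>c>0. \<forall>x \<in> discrete_tiling_space T. \<forall>y \<in> discrete_tiling_space T.
           spectral_dist_sup (discrete_tiling_space T) (tiling_dist \<delta>) x y
             \<le> ennreal c * spectral_dist_inf (discrete_tiling_space T) (tiling_dist \<delta>) x y"
proof -
  interpret tiling_scale \<delta>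
    using assms(5-7) by unfold_locales auto
  interpret levelled_ultrametric "discrete_tiling_space T" "tiling_dist \<delta>"
    by (rule levelled_ultrametric_tiling_space[OF assms(1-3)])
  obtain c R where "\<forall>\<^sub>F r in at_top. real (patch_count T (4 * r)) \<le> c * real (patch_count T r)"
    "\<forall>a\<ge>R. \<forall>r\<ge>R. \<delta> (a * r) \<le> \<delta> a * \<delta> r"
    using assms(4,9) by blast
  from sum_dist_values_le[OF assms(1-3) this] obtain K where K: "0 \<le> K"
    "\<forall>x \<in> discrete_tiling_space T. \<forall>y \<in> discrete_tiling_space T.
      \<forall>V \<subseteq> tiling_dist \<delta> x ` discrete_tiling_space T.
        finite V \<longrightarrow> (\<forall>v\<in>V. 0 < v \<and> v < tiling_dist \<delta> x y) \<longrightarrow> \<Sum>V \<le> K * tiling_dist \<delta> x y"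
    by blast
  have "spectral_dist_sup (discrete_tiling_space T) (tiling_dist \<delta>) x y
      \<le> ennreal (2 * K + 1) * spectral_dist_inf (discrete_tiling_space T) (tiling_dist \<delta>) x y"
    if "x \<in> discrete_tiling_space T" "y \<in> discrete_tiling_space T" for x y
    by (rule spectral_dist_sup_le[OF K(1) that]) (use K(2) in blast)
  then show ?thesis
    using K(1) by (intro exI[of _ "2 * K + 1"]) auto
qed

end
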